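(* Consider the multi-tap channel $h_\tau(\mathbf{t},\mathbf{r})$, $1\le\tau\le T$, defined in the context. Suppose that the vector $\bm{\vartheta}=[\hat\vartheta_1^1,\dots,\hat\vartheta_1^{L_1},\dots,\hat\vartheta_T^1,\dots,\hat\vartheta_T^{L_T}]^{\mathrm T}$ satisfies the LIA condition, and that the ALR assumption holds, i.e., $\mathcal{C}_{\mathrm t}=\mathbb{R}\times[y_{\mathrm t}^{\min},y_{\mathrm t}^{\max}]\times[z_{\mathrm t}^{\min},z_{\mathrm t}^{\max}]$. Then for every real number $\delta$ with $0<\delta<1$ and all real numbers $\nu_1,\dots,\nu_T$, there exist $\mathbf{t}\in\mathcal{C}_{\mathrm t}$ and $\mathbf{r}\in\mathcal{C}_{\mathrm r}$ such that $$\Big|\,\|\mathbf{b}_\tau\|_1 e^{j2\pi\nu_\tau}-h_\tau(\mathbf{t},\mathbf{r})\Big|\le\delta\qquad\text{for all }1\le\tau\le T .$$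
   Context: Notation: $j$ is the imaginary unit; $\|\cdot\|_1$ is the 1-norm of a complex vector (sum of moduli); $(\cdot)^{\mathrm T}$ and $(\cdot)^{\mathrm H}$ denote transpose and conjugate transpose. Channel model: $\lambda>0$ is the wavelength, $T\ge1$ is the number of delay taps, and $L_\tau\ge 1$ is the number of channel paths of tap $\tau$. For each $1\le\tau\le T$, $1\le\ell\le L_\tau$ there are real angles $\hat\theta_\tau^\ell,\hat\phi_\tau^\ell$ (elevation and azimuth angles of departure) and $\tilde\theta_\tau^\ell,\tilde\phi_\tau^\ell$ (elevation and azimuth angles of arrival), and a complex path coefficient $b_\tau^\ell$; put $\mathbf{b}_\tau=[b_\tau^1,\dots,b_\tau^{L_\tau}]^{\mathrm T}$ and $\mathbf{\Sigma}_\tau=\mathrm{diag}\{\mathbf{b}_\tau\}$. Define $$\hat\vartheta_\tau^\ell=\cos\hat\theta_\tau^\ell\cos\hat\phi_\tau^\ell,\quad \hat\varphi_\tau^\ell=\cos\hat\theta_\tau^\ell\sin\hat\phi_\tau^\ell,\quad \hat\omega_\tau^\ell=\sin\hat\theta_\tau^\ell,$$ $$\tilde\vartheta_\tau^\ell=\cos\tilde\theta_\tau^\ell\cos\tilde\phi_\tau^\ell,\quad \tilde\varphi_\tau^\ell=\cos\tilde\theta_\tau^\ell\sin\tilde\phi_\tau^\ell,\quad \tilde\omega_\tau^\ell=\sin\tilde\theta_\tau^\ell,$$ and the wave vectors $\hat{\mathbf{k}}_\tau^\ell=[\hat\vartheta_\tau^\ell,\hat\varphi_\tau^\ell,\hat\omega_\tau^\ell]^{\mathrm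 T}$, $\tilde{\mathbf{k}}_\tau^\ell=[\tilde\vartheta_\tau^\ell,\tilde\varphi_\tau^\ell,\tilde\omega_\tau^\ell]^{\mathrm T}$. For antenna positions $\mathbf{t}=[x_{\mathrm t},y_{\mathrm t},z_{\mathrm t}]^{\mathrm T}\in\mathcal{C}_{\mathrm t}$ and $\mathbf{r}=[x_{\mathrm r},y_{\mathrm r},z_{\mathrm r}]^{\mathrm T}\in\mathcal{C}_{\mathrm r}$ the field-response vectors are $$\mathbf{g}_\tau(\mathbf{t})=\big[e^{j\frac{2\pi}{\lambda}\mathbf{t}^{\mathrm T}\hat{\mathbf{k}}_\tau^1},\dots,e^{j\frac{2\pi}{\lambda}\mathbf{t}^{\mathrm T}\hat{\mathbf{k}}_\tau^{L_\tau}}\big]^{\mathrm T},\qquad \mathbf{f}_\tau(\mathbf{r})=\big[e^{j\frac{2\pi}{\lambda}\mathbf{r}^{\mathrm T}\tilde{\mathbf{k}}_\tau^1},\dots,e^{j\frac{2\pi}{\lambda}\mathbf{r}^{\mathrm T}\tilde{\mathbf{k}}_\tau^{L_\tau}}\big]^{\mathrm T},$$ and the channel impulse response of tap $\tau$ is $$h_\tau(\mathbf{t},\mathbf{r})=\mathbf{f}_\tau(\mathbf{r})^{\mathrm H}\mathbf{\Sigma}_\tau\mathbf{g}_\tau(\mathbf{t}).$$ Regions: $\mathcal{C}_{\mathrm t}$ and $\mathcal{C}_{\mathrm r}$ are the regions in which the transmit and receive antennas can move. The receive region is a non-empty cuboid $\mathcal{C}_{\mathrm r}=[x_{\mathrm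 r}^{\min},x_{\mathrm r}^{\max}]\times[y_{\mathrm r}^{\min},y_{\mathrm r}^{\max}]\times[z_{\mathrm r}^{\min},z_{\mathrm r}^{\max}]$; the transmit region is a non-empty cuboid whose extent along $x_{\mathrm t}$ is arbitrarily large under the ALR (arbitrarily large region) assumption, i.e., $x_{\mathrm t}$ may be any real number, while $y_{\mathrm t}^{\min}\le y_{\mathrm t}^{\max}$ and $z_{\mathrm t}^{\min}\le z_{\mathrm t}^{\max}$ are arbitrary. LIA (linearly independent angle) condition: the $N=\sum_{\tau=1}^T L_\tau$ entries of $\bm{\vartheta}$ are linearly independent over $\mathbb{Q}$, i.e., $\sum_{\tau=1}^{T}\sum_{\ell=1}^{L_\tau}a_\tau^\ell\hat\vartheta_\tau^\ell\ne0$ for every non-zero rational vector $(a_\tau^\ell)\in\mathbb{Q}^N$. *)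

theory Defs
  imports "HOL-Analysis.Analysis" "Jordan_Normal_Form.Matrix"
begin

text \<open>
  Positions and wave vectors live in \<^typ>\<open>real ^ 3\<close>; vectors and matrices whose size is the number
  of paths of a tap are those of \<^theory>\<open>Jordan_Normal_Form.Matrix\<close>, because that number varies with
  the tap. Taps and paths are numbered from 1, entries of \<open>vec\<close> from 0, hence the \<^const>\<open>Suc\<close>.
  Both libraries use \<open>$\<close> and \<open>\<bullet>\<close>, so \<^const>\<open>vec_nth\<close>, \<^const>\<open>inner\<close> and \<^const>\<open>scalar_prod\<close> are
  written in prefix form.
\<close>

definition dir_x :: "real \<Rightarrow> real \<Rightarrow> real" where
  "dir_x \<theta> \<phi> = cos \<theta> * cos \<phi>"

definition dir_y :: "real \<Rightarrow> real \<Rightarrow> real" where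
  "dir_y \<theta> \<phi> = cos \<theta> * sin \<phi>"

definition dir_z :: "real \<Rightarrow> real" where
  "dir_z \<theta> = sin \<theta>"

definition wave_vector :: "real \<Rightarrow> real \<Rightarrow> real ^ 3" where
  "wave_vector \<theta> \<phi> = vector [dir_x \<theta> \<phi>, dir_y \<theta> \<phi>, dir_z \<theta>]"

definition path_vec :: "nat \<Rightarrow> (nat \<Rightarrow> complex) \<Rightarrow> complex Matrix.vec" where
  "path_vec n b = Matrix.vec n (\<lambda>i. b (Suc i))"

definition field_response ::
  "real \<Rightarrow> nat \<Rightarrow> (nat \<Rightarrow> real) \<Rightarrow> (nat \<Rightarrow> real) \<Rightarrow> real ^ 3 \<Rightarrow> complex Matrix.vec" where
  "field_response wl n \<theta> \<phi> p =
     path_vec n (\<lambda>l. exp (\<i> * complex_of_real (2 * pi / wl * inner p (wave_vector (\<theta> l) (\<phi> l)))))"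

definition path_matrix :: "complex Matrix.vec \<Rightarrow> complex mat" where
  "path_matrix b = mat_diag (dim_vec b) (vec_index b)"

text \<open>
  One tap with \<open>n\<close> paths: \<open>\<theta>t\<close>, \<open>\<phi>t\<close> are the elevation and azimuth angles of departure,
  \<open>\<theta>r\<close>, \<open>\<phi>r\<close> those of arrival, and \<open>wl\<close> is the wavelength.
\<close>

definition channel_response ::
  "real \<Rightarrow> nat \<Rightarrow> (nat \<Rightarrow> real) \<Rightarrow> (nat \<Rightarrow> real) \<Rightarrow> (nat \<Rightarrow> real) \<Rightarrow> (nat \<Rightarrow> real) \<Rightarrow>
     (nat \<Rightarrow> complex) \<Rightarrow> real ^ 3 \<Rightarrow> real ^ 3 \<Rightarrow> complex" where
  "channel_response wl n \<theta>t \<phi>t \<theta>r \<phi>r b t r =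
     scalar_prod (conjugate (field_response wl n \<theta>r \<phi>r r))
       (path_matrix (path_vec n b) *\<^sub>v field_response wl n \<theta>t \<phi>t t)"

definition norm1 :: "complex Matrix.vec \<Rightarrow> real" where
  "norm1 v = (\<Sum>i<dim_vec v. cmod (vec_index v i))"

definition cuboid :: "real set \<Rightarrow> real set \<Rightarrow> real set \<Rightarrow> (real ^ 3) set" where
  "cuboid X Y Z = {p. vec_nth p 1 \<in> X \<and> vec_nth p 2 \<in> Y \<and> vec_nth p 3 \<in> Z}"

text \<open>
  Independence over the rationals of the family \<open>v \<tau> l\<close>, not of its set of values: a repeated value
  violates the condition.
\<close>

definition LIA :: "nat \<Rightarrow> (nat \<Rightarrow> nat) \<Rightarrow> (nat \<Rightarrow> nat \<Rightarrow> real) \<Rightarrow> bool" where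
  "LIA T L v \<longleftrightarrow>
     (\<forall>a :: nat \<Rightarrow> nat \<Rightarrow> rat. (\<exists>\<tau>\<in>{1..T}. \<exists>l\<in>{1..L \<tau>}. a \<tau> l \<noteq> 0) \<longrightarrow>
        (\<Sum>\<tau>=1..T. \<Sum>l=1..L \<tau>. of_rat (a \<tau> l) * v \<tau> l) \<noteq> 0)"

end

theory Submission
  imports Defs
begin

text \<open>
  Fix any receive position and any \<open>y\<close>, \<open>z\<close> for the transmit antenna. Moving the transmit antenna
  along the \<open>x\<close> axis then turns the phase of each summand of each tap linearly, with the speeds
  \<open>\<vartheta>\<close> given by the LIA condition. By Kronecker's theorem, some \<open>x\<close> brings all these phases
  simultaneously close to the prescribed phase of their tap, so the summands add up almost without
  cancellation.
\<close>

text \<open>Adapts \<open>Kronecker_thm_1\<close>, which is about families indexed by an initial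
  segment of the naturals and independence of their set of values, to families over any finite index
  set. Independence of the family yields both injectivity and independence of the image.\<close>

lemma Kronecker_finite:
  fixes \<theta> \<alpha> :: "'i \<Rightarrow> real"
  assumes "finite I" and "\<epsilon> > 0"
    and indep: "\<And>a :: 'i \<Rightarrow> int. (\<Sum>i\<in>I. of_int (a i) * \<theta> i) = 0 \<Longrightarrow> \<forall>i\<in>I. a i = 0"
  obtains t :: real and h :: "'i \<Rightarrow> int" where "\<And>i. i \<in> I \<Longrightarrow> \<bar>t * \<theta> i - of_int (h i) - \<alpha> i\<bar> < \<epsilon>"
proof -
  \<comment> \<open>The reals as a module over the integers, so that \<open>independent\<close>
    below refers to integer relations.\<close>
  interpret Modules.module "\<lambda>r. (*) (real_of_int r)"
    by (simp add: Modules.module.intro distrib_left mult.commute)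
  have inj: "inj_on \<theta> I"
  proof (rule inj_onI, rule ccontr)
    fix i j assume ij: "i \<in> I" "j \<in> I" "\<theta> i = \<theta> j" "i \<noteq> j"
    \<comment> \<open>Equal values at \<open>i\<close> and \<open>j\<close> would give a relation
      with coefficients 1 and -1.\<close>
    have "(\<Sum>k\<in>I. of_int ((if k = i then 1 else 0) - (if k = j then 1 else 0)) * \<theta> k)
        = (\<Sum>k\<in>I. (if k = i then \<theta> k else 0) - (if k = j then \<theta> k else 0))"
      by (intro sum.cong) auto
    also have "\<dots> = 0"
      using ij \<open>finite I\<close> by (simp add: sum_subtractf)
    finally show False
      using indep ij by fastforce
  qed
  have "independent (\<theta> ` I)"
    unfolding independent_explicit_module
  proof (intro allI impI)
    fix V :: "real set" and u :: "real \<Rightarrow> int" and v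
    assume V: "V \<subseteq> \<theta> ` I" "(\<Sum>v\<in>V. of_int (u v) * v) = 0" "v \<in> V"
    \<comment> \<open>A relation on part of the image is extended by zero and pulled back along the
      injective \<open>\<theta>\<close> to a relation of the family.\<close>
    have "(\<Sum>i\<in>I. of_int (if \<theta> i \<in> V then u (\<theta> i) else 0) * \<theta> i)
        = (\<Sum>w\<in>\<theta> ` I. of_int (if w \<in> V then u w else 0) * w)"
      by (simp add: sum.reindex[OF inj])
    also have "\<dots> = (\<Sum>w\<in>V. of_int (u w) * w)"
      using V(1) \<open>finite I\<close> by (intro sum.mono_neutral_cong_right) auto
    finally show "u v = 0"
      using indep[of "\<lambda>i. if \<theta> i \<in> V then u (\<theta> i) else 0"] V by fastforce
  qed
  moreover obtain f where f: "bij_betw f {..<card I} I"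
    using ex_bij_betw_nat_finite[OF \<open>finite I\<close>] by (auto simp: atLeast0LessThan)
  ultimately have "independent ((\<theta> \<circ> f) ` {..<card I})"
    by (metis bij_betw_imp_surj_on image_comp)
  moreover have "inj_on (\<theta> \<circ> f) {..<card I}"
    using f inj by (simp add: comp_inj_on bij_betw_def)
  ultimately obtain t h
    where th: "\<And>k. k < card I \<Longrightarrow> \<bar>t * (\<theta> \<circ> f) k - of_int (h k) - (\<alpha> \<circ> f) k\<bar> < \<epsilon>"
    using Kronecker_thm_1[OF _ _ \<open>\<epsilon> > 0\<close>] by blast
  show thesis
  proof (rule that)
    fix i assume "i \<in> I"
    then show "\<bar>t * \<theta> i - of_int ((h \<circ> inv_into {..<card I} f) i) - \<alpha> i\<bar> < \<epsilon>"
      using th[of "inv_into {..<card I} f i"] f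
      by (metis bij_betw_imp_surj_on comp_apply f_inv_into_f inv_into_into lessThan_iff)
  qed
qed

text \<open>Integer coefficients are rational ones; the double sum is flattened to pairs, the index
  set to which \<open>Kronecker_finite\<close> is applied.\<close>

lemma LIA_int:
  fixes a :: "nat \<times> nat \<Rightarrow> int"
  assumes "LIA T L v" and "(\<Sum>(\<tau>, l)\<in>Sigma {1..T} (\<lambda>\<tau>. {1..L \<tau>}). of_int (a (\<tau>, l)) * v \<tau> l) = 0"
  shows "\<forall>p\<in>Sigma {1..T} (\<lambda>\<tau>. {1..L \<tau>}). a p = 0"
proof (rule ccontr)
  assume "\<not> ?thesis"
  then have "\<exists>\<tau>\<in>{1..T}. \<exists>l\<in>{1..L \<tau>}. (of_int (a (\<tau>, l)) :: rat) \<noteq> 0"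
    by auto
  then have "(\<Sum>\<tau>=1..T. \<Sum>l=1..L \<tau>. of_rat (of_int (a (\<tau>, l))) * v \<tau> l) \<noteq> 0"
    using assms(1)[unfolded LIA_def, rule_format, of "\<lambda>\<tau> l. of_int (a (\<tau>, l))"] by blast
  with assms(2) show False
    by (simp add: sum.Sigma)
qed

text \<open>A chord of the unit circle is no longer than an arc joining its ends.\<close>

lemma cmod_exp_i_diff_le:
  "cmod (exp (\<i> * complex_of_real x) - exp (\<i> * complex_of_real y)) \<le> \<bar>x - y\<bar>"
proof -
  have "exp (\<i> * complex_of_real x) - exp (\<i> * complex_of_real y)
      = exp (\<i> * complex_of_real y) * (exp (\<i> * complex_of_real (x - y)) - 1)"
    by (simp add: algebra_simps flip: exp_add)
  then have "cmod (exp (\<i> * complex_of_real x) - exp (\<i> * complex_of_real y))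
      = 2 * \<bar>sin ((x - y) / 2)\<bar>"
    using dist_exp_i_1[of "x - y"] by (simp add: norm_mult)
  also have "\<dots> \<le> \<bar>x - y\<bar>"
    using abs_sin_x_le_abs_x[of "(x - y) / 2"] by simp
  finally show ?thesis .
qed

lemma norm1_path_vec: "norm1 (path_vec n b) = (\<Sum>l=1..n. cmod (b l))"
  unfolding norm1_def path_vec_def by (simp add: sum.atLeast1_atMost_eq)

text \<open>The diagonal matrix acts entrywise, and conjugation negates the receive phases, so each
  path contributes a single exponential of a phase difference.\<close>

lemma channel_response_eq:
  "channel_response wl n \<theta>t \<phi>t \<theta>r \<phi>r b t r =
    (\<Sum>l=1..n. b l * exp (\<i> * complex_of_real (2 * pi / wl *
      (inner t (wave_vector (\<theta>t l) (\<phi>t l)) - inner r (wave_vector (\<theta>r l) (\<phi>r l))))))"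
proof -
  have diag: "path_matrix (path_vec n b) *\<^sub>v path_vec n g = path_vec n (\<lambda>l. b l * g l)" for g
  proof (rule eq_vecI)
    fix i assume "i < dim_vec (path_vec n (\<lambda>l. b l * g l))"
    then have i: "i < n" by (simp add: path_vec_def)
    then show "vec_index (path_matrix (path_vec n b) *\<^sub>v path_vec n g) i
        = vec_index (path_vec n (\<lambda>l. b l * g l)) i"
      by (simp add: scalar_prod_def path_matrix_def mat_diag_def path_vec_def
          if_distrib[of "\<lambda>x. x * _"] cong: if_cong)
  qed (simp add: path_matrix_def path_vec_def mat_diag_def)
  have "channel_response wl n \<theta>t \<phi>t \<theta>r \<phi>r b t r =
    (\<Sum>i<n. cnj (exp (\<i> * complex_of_real (2 * pi / wl * inner r (wave_vector (\<theta>r (Suc i)) (\<phi>r (Suc i)))))) *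
      (b (Suc i) * exp (\<i> * complex_of_real (2 * pi / wl * inner t (wave_vector (\<theta>t (Suc i)) (\<phi>t (Suc i)))))))"
    unfolding channel_response_def field_response_def diag
    by (simp add: scalar_prod_def path_vec_def atLeast0LessThan)
  also have "\<dots> = (\<Sum>i<n. b (Suc i) * exp (\<i> * complex_of_real (2 * pi / wl *
      (inner t (wave_vector (\<theta>t (Suc i)) (\<phi>t (Suc i))) - inner r (wave_vector (\<theta>r (Suc i)) (\<phi>r (Suc i)))))))"
    by (intro sum.cong) (auto simp: exp_cnj algebra_simps simp flip: exp_add)
  finally show ?thesis
    by (simp add: sum.atLeast1_atMost_eq)
qed

text \<open>Phases are counted in turns. In polar form the second term has modulus
  \<open>cmod z\<close> and phase \<open>\<psi> + Arg z / (2 * pi)\<close>; the \<open>m\<close>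
  full turns drop out, and the chord bound applies.\<close>

lemma cmod_phase_aligned_le:
  fixes z :: complex and m :: int
  assumes "\<bar>\<psi> + Arg z / (2 * pi) - of_int m - \<nu>\<bar> \<le> \<epsilon>"
  shows "cmod (of_real (cmod z) * exp (\<i> * of_real (2 * pi * \<nu>)) - z * exp (\<i> * of_real (2 * pi * \<psi>)))
    \<le> cmod z * (2 * pi * \<epsilon>)"
proof -
  define \<beta> where "\<beta> = 2 * pi * (\<psi> + Arg z / (2 * pi) - of_int m)"
  have "z * exp (\<i> * of_real (2 * pi * \<psi>)) = of_real (cmod z) * (cis (Arg z) * cis (2 * pi * \<psi>))"
    by (metis cis_conv_exp mult.assoc rcis_cmod_Arg rcis_def)
  also have "cis (Arg z) * cis (2 * pi * \<psi>) = cis \<beta> * cis (2 * pi * of_int m)"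
    by (simp add: cis_mult \<beta>_def algebra_simps)
  also have "\<dots> = cis \<beta>"
    by (simp add: cis_multiple_2pi)
  finally have "cmod (of_real (cmod z) * exp (\<i> * of_real (2 * pi * \<nu>)) - z * exp (\<i> * of_real (2 * pi * \<psi>)))
      = cmod z * cmod (exp (\<i> * of_real (2 * pi * \<nu>)) - exp (\<i> * of_real \<beta>))"
    by (simp add: cis_conv_exp norm_mult flip: right_diff_distrib)
  also have "\<dots> \<le> cmod z * \<bar>2 * pi * \<nu> - \<beta>\<bar>"
    by (intro mult_left_mono cmod_exp_i_diff_le) simp
  also have "\<bar>2 * pi * \<nu> - \<beta>\<bar> = 2 * pi * \<bar>\<psi> + Arg z / (2 * pi) - of_int m - \<nu>\<bar>"
    by (simp add: \<beta>_def abs_mult abs_minus_commute flip: right_diff_distrib)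
  also have "cmod z * \<dots> \<le> cmod z * (2 * pi * \<epsilon>)"
    using assms by (intro mult_left_mono) auto
  finally show ?thesis .
qed

theorem theorem1:
  fixes wl :: real and T :: nat and L :: "nat \<Rightarrow> nat"
    and \<theta>t \<phi>t \<theta>r \<phi>r :: "nat \<Rightarrow> nat \<Rightarrow> real"
    and b :: "nat \<Rightarrow> nat \<Rightarrow> complex"
    and yt_min yt_max zt_min zt_max :: real
    and xr_min xr_max yr_min yr_max zr_min zr_max :: real
    and Ct Cr :: "(real ^ 3) set"
    and \<delta> :: real and \<nu> :: "nat \<Rightarrow> real"
  assumes "wl > 0" and "T \<ge> 1" and "\<And>\<tau>. \<tau> \<in> {1..T} \<Longrightarrow> L \<tau> \<ge> 1"
    and "yt_min \<le> yt_max" and "zt_min \<le> zt_max"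
    and "Ct = cuboid UNIV {yt_min..yt_max} {zt_min..zt_max}"
    and "xr_min \<le> xr_max" and "yr_min \<le> yr_max" and "zr_min \<le> zr_max"
    and "Cr = cuboid {xr_min..xr_max} {yr_min..yr_max} {zr_min..zr_max}"
    and "LIA T L (\<lambda>\<tau> l. dir_x (\<theta>t \<tau> l) (\<phi>t \<tau> l))"
    and "0 < \<delta>" and "\<delta> < 1"
  shows "\<exists>t\<in>Ct. \<exists>r\<in>Cr. \<forall>\<tau>\<in>{1..T}.
    cmod (complex_of_real (norm1 (path_vec (L \<tau>) (b \<tau>))) * exp (\<i> * complex_of_real (2 * pi * \<nu> \<tau>))
      - channel_response wl (L \<tau>) (\<theta>t \<tau>) (\<phi>t \<tau>) (\<theta>r \<tau>) (\<phi>r \<tau>) (b \<tau>) t r) \<le> \<delta>"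
proof -
  define I where "I = Sigma {1..T} (\<lambda>\<tau>. {1..L \<tau>})"
  define M where "M = (\<Sum>\<tau>=1..T. \<Sum>l=1..L \<tau>. cmod (b \<tau> l))"
  \<comment> \<open>Phase errors of \<open>\<epsilon>\<close> turns cost a tap at most
    \<open>M * 2 * pi * \<epsilon>\<close>. Since \<open>M\<close> sums over all taps, one
    \<open>\<epsilon>\<close> serves them all; the \<open>+ 1\<close> keeps the denominator positive
    if every coefficient is 0.\<close>
  define \<epsilon> where "\<epsilon> = \<delta> / (2 * pi * (M + 1))"
  have "M \<ge> 0"
    unfolding M_def by (intro sum_nonneg) auto
  then have "\<epsilon> > 0"
    using \<open>0 < \<delta>\<close> by (simp add: \<epsilon>_def)
  define r :: "real ^ 3" where "r = vector [xr_min, yr_min, zr_min]"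
  \<comment> \<open>\<open>d\<close> is the part of the path length difference that does not change
    with the transmit x coordinate; \<open>c\<close> is the resulting fixed phase in turns,
    including that of the coefficient.\<close>
  define d where "d \<tau> l = dir_y (\<theta>t \<tau> l) (\<phi>t \<tau> l) * yt_min + dir_z (\<theta>t \<tau> l) * zt_min
      - inner r (wave_vector (\<theta>r \<tau> l) (\<phi>r \<tau> l))" for \<tau> l
  define c where "c \<tau> l = d \<tau> l / wl + Arg (b \<tau> l) / (2 * pi)" for \<tau> l
  define v where "v = (\<lambda>(\<tau>, l). dir_x (\<theta>t \<tau> l) (\<phi>t \<tau> l))"
  \<comment> \<open>What the motion along x has to contribute, modulo full turns.\<close>
  define \<alpha> where "\<alpha> = (\<lambda>(\<tau>, l). \<nu> \<tau> - c \<tau> l)"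
  have "finite I"
    by (simp add: I_def)
  have indep: "\<forall>p\<in>I. a p = 0" if "(\<Sum>p\<in>I. of_int (a p) * v p) = 0" for a :: "nat \<times> nat \<Rightarrow> int"
    using LIA_int[OF \<open>LIA T L _\<close>, of a] that by (simp add: I_def v_def case_prod_beta)
  obtain s h where "\<And>p. p \<in> I \<Longrightarrow> \<bar>s * v p - of_int (h p) - \<alpha> p\<bar> < \<epsilon>"
    using Kronecker_finite[OF \<open>finite I\<close> \<open>\<epsilon> > 0\<close> indep] by blast
  then have sh: "\<bar>s * dir_x (\<theta>t \<tau> l) (\<phi>t \<tau> l) - of_int (h (\<tau>, l)) - (\<nu> \<tau> - c \<tau> l)\<bar> < \<epsilon>"
    if "\<tau> \<in> {1..T}" "l \<in> {1..L \<tau>}" for \<tau> l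
    using that by (fastforce simp: I_def v_def \<alpha>_def)
  \<comment> \<open>The factor \<open>wl\<close> cancels the wavelength, so that \<open>s\<close>
    multiplies the x directions to give turns.\<close>
  define t :: "real ^ 3" where "t = vector [wl * s, yt_min, zt_min]"
  define \<psi> where "\<psi> \<tau> l = (inner t (wave_vector (\<theta>t \<tau> l) (\<phi>t \<tau> l))
      - inner r (wave_vector (\<theta>r \<tau> l) (\<phi>r \<tau> l))) / wl" for \<tau> l
  have \<psi>: "\<psi> \<tau> l = s * dir_x (\<theta>t \<tau> l) (\<phi>t \<tau> l) + d \<tau> l / wl" for \<tau> l
    using \<open>wl > 0\<close> unfolding \<psi>_def d_def t_def wave_vector_def
    by (simp add: inner_vec_def sum_3 field_simps)
  have "cmod (complex_of_real (norm1 (path_vec (L \<tau>) (b \<tau>))) * exp (\<i> * complex_of_real (2 * pi * \<nu> \<tau>))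
      - channel_response wl (L \<tau>) (\<theta>t \<tau>) (\<phi>t \<tau>) (\<theta>r \<tau>) (\<phi>r \<tau>) (b \<tau>) t r) \<le> \<delta>"
    (is "cmod ?D \<le> \<delta>") if \<tau>: "\<tau> \<in> {1..T}" for \<tau>
  proof -
    \<comment> \<open>The target is split along the paths: each gets modulus
      \<open>cmod (b \<tau> l)\<close> and the common phase \<open>\<nu> \<tau>\<close>.\<close>
    have "?D = (\<Sum>l=1..L \<tau>. of_real (cmod (b \<tau> l)) * exp (\<i> * of_real (2 * pi * \<nu> \<tau>))
        - b \<tau> l * exp (\<i> * of_real (2 * pi * \<psi> \<tau> l)))"
      by (simp add: norm1_path_vec channel_response_eq \<psi>_def sum_subtractf sum_distrib_right)
    also have "cmod \<dots> \<le> (\<Sum>l=1..L \<tau>. cmod (b \<tau> l) * (2 * pi * \<epsilon>))"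
    proof (rule sum_norm_le)
      fix l assume "l \<in> {1..L \<tau>}"
      \<comment> \<open>Moving \<open>c\<close> to the other side turns Kronecker's estimate into
        one on the total phase, with \<open>h (\<tau>, l)\<close> as the number of full
        turns.\<close>
      with sh[OF \<tau>] have "\<bar>\<psi> \<tau> l + Arg (b \<tau> l) / (2 * pi) - of_int (h (\<tau>, l)) - \<nu> \<tau>\<bar> \<le> \<epsilon>"
        by (force simp: \<psi> c_def algebra_simps)
      then show "cmod (of_real (cmod (b \<tau> l)) * exp (\<i> * of_real (2 * pi * \<nu> \<tau>))
          - b \<tau> l * exp (\<i> * of_real (2 * pi * \<psi> \<tau> l))) \<le> cmod (b \<tau> l) * (2 * pi * \<epsilon>)"
        by (rule cmod_phase_aligned_le)
    qed
    also have "\<dots> = (\<Sum>l=1..L \<tau>. cmod (b \<tau> l)) * (2 * pi * \<epsilon>)"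
      by (simp add: sum_distrib_right)
    also have "\<dots> \<le> (M + 1) * (2 * pi * \<epsilon>)"
    proof (rule mult_right_mono)
      have "(\<Sum>l=1..L \<tau>. cmod (b \<tau> l)) \<le> M"
        unfolding M_def using \<tau> by (intro member_le_sum) (auto intro: sum_nonneg)
      then show "(\<Sum>l=1..L \<tau>. cmod (b \<tau> l)) \<le> M + 1"
        by simp
    qed (use \<open>\<epsilon> > 0\<close> in simp)
    also have "\<dots> = \<delta>"
      using \<open>M \<ge> 0\<close> by (simp add: \<epsilon>_def)
    finally show ?thesis .
  qed
  moreover have "t \<in> Ct"
    using assms by (simp add: t_def cuboid_def)
  moreover have "r \<in> Cr"
    using assms by (simp add: r_def cuboid_def)
  ultimately show ?thesis
    by blast
qed

end
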